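(* Let $n\ge 1$ and let $w \in \mathfrak{S}_n$. Then the depth of $w$ is given by $$\mathrm{dp}(w) = \sum_{i\in\{1,\dots,n\}:\ w(i) > i} (w(i)-i).$$
   Context: $\mathfrak{S}_n$ is the group of permutations of $\{1,\dots,n\}$. For $1\le i<j\le n$, $t_{ij}\in\mathfrak{S}_n$ denotes the transposition interchanging $i$ and $j$; its depth is $j-i$. The depth of $w\in\mathfrak{S}_n$ is the minimum total depth of a factorization of $w$ into transpositions: $$\mathrm{dp}(w)=\min\Big\{\sum_{r=1}^k (j_r-i_r) : k\ge 0,\ w=t_{i_1j_1}\cdots t_{i_kj_k},\ i_r<j_r\Big\},$$ where the identity is the empty product, of depth $0$. *)

theory Defs
  imports "HOL-Combinatorics.Permutations"
begin

text \<open>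
  The symmetric group on \<open>{1, \<dots>, n}\<close> consists of the \<open>w :: nat \<Rightarrow> nat\<close> with
  \<open>w permutes {1..n}\<close>, i.e. the bijections that fix every number outside \<open>{1..n}\<close>.
  A word in the transpositions \<open>t\<^sub>i\<^sub>j\<close> is the list of its index pairs \<open>(i, j)\<close>, and
  \<^const>\<open>apply_transps\<close> is the product of the word, composed as functions: the leftmost
  factor is applied last.
\<close>

definition is_transp_word :: "nat \<Rightarrow> (nat \<times> nat) list \<Rightarrow> bool" where
  "is_transp_word n ts \<longleftrightarrow> (\<forall>(i, j) \<in> set ts. 1 \<le> i \<and> i < j \<and> j \<le> n)"

definition total_depth :: "(nat \<times> nat) list \<Rightarrow> nat" where
  "total_depth ts = (\<Sum>(i, j)\<leftarrow>ts. j - i)"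

definition depth :: "nat \<Rightarrow> (nat \<Rightarrow> nat) \<Rightarrow> nat" where
  "depth n w = (LEAST d. \<exists>ts. is_transp_word n ts \<and> apply_transps ts = w \<and> total_depth ts = d)"

text \<open>The minimum is over a nonempty set, so \<^const>\<open>Least\<close> is indeed an attained minimum.\<close>

lemma transp_word_exists:
  assumes "w permutes {1..n}"
  shows "\<exists>ts. is_transp_word n ts \<and> apply_transps ts = w"
  using assms finite_atLeastAtMost[of 1 n]
proof (induction rule: permutes_induct)
  case id
  show ?case by (rule exI[of _ "[]"]) (auto simp: is_transp_word_def)
next
  case (swap a b p)
  then obtain ts where ts: "is_transp_word n ts" "apply_transps ts = p" by blast
  have "is_transp_word n ((min a b, max a b) # ts)"
    using swap.hyps ts by (auto simp: is_transp_word_def min_def max_def)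
  moreover have "apply_transps ((min a b, max a b) # ts) = Transposition.transpose a b \<circ> p"
    using ts by (simp add: min_def max_def transpose_commute)
  ultimately show ?case by blast
qed

end

theory Submission
  imports Defs
begin

text \<open>
  Let \<open>E w\<close> be the sum of the excedances \<open>w i - i\<close>. Multiplying \<open>w\<close> by \<open>t\<^sub>i\<^sub>j\<close> on the right swaps
  the values at \<open>i\<close> and \<open>j\<close>, and raises \<open>E\<close> by at most \<open>j - i\<close>, so every word for \<open>w\<close> has depth at
  least \<open>E w\<close>. Conversely, multiplication by \<open>t\<^sub>i\<^sub>j\<close> lowers \<open>E\<close> by exactly \<open>j - i\<close> as soon as
  \<open>w j \<le> i < j \<le> w i\<close>. If \<open>w\<close> is not the identity, such a pair exists for the largest \<open>i\<close> with
  \<open>i < w i\<close>: otherwise \<open>w\<close> would map \<open>{i..w i}\<close> injectively into \<open>{i<..w i}\<close>.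
\<close>

text \<open>Subtraction is truncated, so only the positions \<open>i\<close> with \<open>w i > i\<close> contribute.\<close>

definition excedance_sum :: "nat \<Rightarrow> (nat \<Rightarrow> nat) \<Rightarrow> nat" where
  "excedance_sum n w = (\<Sum>i=1..n. w i - i)"

lemma excedance_sum_eq:
  "excedance_sum n w = (\<Sum>i\<in>{i \<in> {1..n}. w i > i}. w i - i)"
  unfolding excedance_sum_def by (rule sum.mono_neutral_right) auto

lemma excedance_sum_split:
  assumes "1 \<le> i" "i < j" "j \<le> n"
  shows "excedance_sum n w = (w i - i) + (w j - j) + (\<Sum>k\<in>{1..n} - {i, j}. w k - k)"
proof -
  have "excedance_sum n w = (\<Sum>k\<in>{i, j}. w k - k) + (\<Sum>k\<in>{1..n} - {i, j}. w k - k)"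
    unfolding excedance_sum_def using assms by (subst add.commute, intro sum.subset_diff) auto
  then show ?thesis using assms by simp
qed

text \<open>Subtracted terms are moved across the equation, so truncated subtraction loses nothing;
  both the upper bound and the exact drop follow from it.\<close>

lemma excedance_sum_comp_transpose:
  assumes "1 \<le> i" "i < j" "j \<le> n"
  shows "excedance_sum n (w \<circ> transpose i j) + (w i - i) + (w j - j)
       = excedance_sum n w + (w j - i) + (w i - j)"
proof -
  have "(\<Sum>k\<in>{1..n} - {i, j}. (w \<circ> transpose i j) k - k) = (\<Sum>k\<in>{1..n} - {i, j}. w k - k)"
    by (rule sum.cong) (auto simp: transpose_def)
  then show ?thesis
    using excedance_sum_split[OF assms, of w] excedance_sum_split[OF assms, of "w \<circ> transpose i j"]
    by simp
qed

lemma excedance_sum_le_total_depth: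
  assumes "is_transp_word n ts"
  shows "excedance_sum n (apply_transps ts) \<le> total_depth ts"
  using assms
proof (induction ts rule: rev_induct)
  case Nil
  show ?case by (simp add: excedance_sum_def)
next
  case (snoc t ts)
  obtain i j where t: "t = (i, j)" by force
  with snoc.prems have ij: "1 \<le> i" "i < j" "j \<le> n" and ts: "is_transp_word n ts"
    by (auto simp: is_transp_word_def)
  \<comment> \<open>The value at \<open>j\<close> moves left to \<open>i\<close>, where its
    excedance grows by at most \<open>j - i\<close>; the value at \<open>i\<close> moves right and
    gains nothing.\<close>
  have "excedance_sum n (apply_transps ts \<circ> transpose i j)
        \<le> excedance_sum n (apply_transps ts) + (j - i)"
    using excedance_sum_comp_transpose[OF ij, of "apply_transps ts"] ij by linarith
  with snoc.IH[OF ts] show ?case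
    by (simp add: t total_depth_def o_def)
qed

lemma exists_shortening_transposition:
  fixes w :: "nat \<Rightarrow> nat"
  assumes w: "w permutes {1..n}" and ne: "w \<noteq> id"
  obtains i j where "1 \<le> i" "i < j" "j \<le> n" "w j \<le> i" "j \<le> w i"
proof -
  let ?X = "{i \<in> {1..n}. w i > i}"
  have "?X \<noteq> {}"
  proof
    assume "?X = {}"
    then have "\<forall>i\<in>{1..n}. w i \<le> i" by (auto simp: not_less)
    with permutes_natset_le[OF w] ne show False by simp
  qed
  then have "Max ?X \<in> ?X" by (intro Max_in) auto
  moreover define i where "i = Max ?X"
  ultimately have i: "1 \<le> i" "i \<le> n" "i < w i" by simp_all
  have wi: "w i \<le> n" using permutes_in_image[OF w, of i] i by auto
  have le: "w k \<le> k" if "i < k" "k \<le> n" for k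
  proof (rule ccontr)
    assume "\<not> w k \<le> k"
    with that have "k \<in> ?X" by auto
    then have "k \<le> i" unfolding i_def by (intro Max_ge) auto
    with that show False by simp
  qed
  have "\<exists>j\<in>{i<..w i}. w j \<le> i"
  proof (rule ccontr)
    assume neg: "\<not> ?thesis"
    have "w ` {i..w i} \<subseteq> {i<..w i}"
    proof
      fix v assume "v \<in> w ` {i..w i}"
      then obtain k where k: "v = w k" "i \<le> k" "k \<le> w i" by auto
      show "v \<in> {i<..w i}"
      proof (cases "k = i")
        case False
        \<comment> \<open>Here \<open>i < k\<close>, so \<open>neg\<close> gives
          \<open>i < w k\<close>, and maximality of \<open>i\<close> gives
          \<open>w k \<le> k \<le> w i\<close>.\<close>
        with k neg le[of k] wi show ?thesis by (auto simp: not_le)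
      qed (use k i in auto)
    qed
    then have "card {i..w i} \<le> card {i<..w i}"
      by (intro card_inj_on_le[OF permutes_inj_on[OF w]]) auto
    with i show False by simp
  qed
  then obtain j where "i < j" "j \<le> w i" "w j \<le> i" by auto
  with i wi show thesis by (intro that[of i j]) simp_all
qed

lemma exists_word_of_total_depth_excedance_sum:
  assumes "w permutes {1..n}"
  shows "\<exists>ts. is_transp_word n ts \<and> apply_transps ts = w \<and> total_depth ts = excedance_sum n w"
  using assms
proof (induction "excedance_sum n w" arbitrary: w rule: less_induct)
  case less
  show ?case
  proof (cases "w = id")
    case True
    then show ?thesis
      by (intro exI[of _ "[]"]) (simp add: is_transp_word_def total_depth_def excedance_sum_def)
  next
    case False
    with less.prems obtain i j where ij: "1 \<le> i" "i < j" "j \<le> n" "w j \<le> i" "j \<le> w i"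
      by (rule exists_shortening_transposition)
    let ?v = "w \<circ> transpose i j"
    \<comment> \<open>Both terms in \<open>w j\<close> vanish since \<open>w j \<le> i < j\<close>,
      and \<open>j \<le> w i\<close> keeps \<open>w i - j\<close> untruncated.\<close>
    have E: "excedance_sum n ?v + (j - i) = excedance_sum n w"
      using excedance_sum_comp_transpose[OF ij(1-3), of w] ij by linarith
    have "?v permutes {1..n}"
      using ij less.prems by (intro permutes_compose permutes_swap_id) auto
    moreover have "excedance_sum n ?v < excedance_sum n w"
      using E ij by linarith
    ultimately obtain ts where
      ts: "is_transp_word n ts" "apply_transps ts = ?v" "total_depth ts = excedance_sum n ?v"
      using less.hyps by blast
    have "is_transp_word n (ts @ [(i, j)])"
      using ts(1) ij by (auto simp: is_transp_word_def)
    moreover have "apply_transps (ts @ [(i, j)]) = w"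
      using ts(2) by (simp add: comp_assoc)
    moreover have "total_depth (ts @ [(i, j)]) = excedance_sum n w"
      using ts(3) E by (simp add: total_depth_def)
    ultimately show ?thesis by blast
  qed
qed

theorem theorem1p1:
  fixes n :: nat and w :: "nat \<Rightarrow> nat"
  assumes "n \<ge> 1" and "w permutes {1..n}"
  shows "depth n w = (\<Sum>i\<in>{i \<in> {1..n}. w i > i}. w i - i)"
  unfolding depth_def excedance_sum_eq[symmetric]
proof (rule Least_equality)
  show "\<exists>ts. is_transp_word n ts \<and> apply_transps ts = w \<and> total_depth ts = excedance_sum n w"
    using assms(2) by (rule exists_word_of_total_depth_excedance_sum)
qed (use excedance_sum_le_total_depth in blast)

end
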